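(* Let $U$ be a nonempty set. For every MSO formula $\varphi$, the following are equivalent: (i) $\models^{d'}\varphi$ (standard validity over $U$); (ii) for every interpretation $II$ over $U$ and all assignments $gg:V\to U$, $GG:V_2\to\mathcal P(U)$ such that $\langle II,\mathrm{Range}(gg),\mathrm{Range}(GG)\rangle\subseteq_{E}\langle II,U,\mathcal P(U)\rangle$ (elementary substructure of the full model), the proposition $(\!|\varphi|\!)_{II,gg,GG}$ is true.
   Context: **Syntax.** Relation symbols $R=\mathbb N$, first-order variables $V=\mathbb N$ and second-order (monadic) variables $V_2=\mathbb N$ (the two kinds of variables form separate namespaces). MSO formulas: $\varphi,\psi ::= r(x,y)\mid X(x)\mid\neg\varphi\mid\varphi\wedge\psi\mid\exists x.\varphi\mid\exists X.\varphi$ with $r\in R$, $x,y\in V$, $X\in V_2$ (no equality). **Semantics.** $U$ is a fixed nonempty set (the type of individuals). An interpretation $I$ over $U$ assigns to each $r\in R$ a binary relation $I(r)\subseteq U\times U$. Given $I$, a set $D\subseteq U$, a family $E\subseteq\mathcal P(U)$ (no closure condition on $E$), and assignments $g:V\to U$, $G:V_2\to\mathcal P(U)$, truth $\langle I,D,E\rangle,g,G\models^d\varphi$ is defined recursively: $r(x,y)$ holds iff $(g(x),g(y))\in I(r)$; $X(x)$ holds iff $g(x)\in G(X)$; $\neg,\wedge$ are classical; $\exists x.\varphi$ holds iff $\langle I,D,E\rangle,g[x\leftarrow d],G\models^d\varphi$ for some $d\in D$; $\exists X.\varphi$ holds iff $\langle I,D,E\rangle,g,G\langle X\leftarrow S\rangle\models^d\varphi$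 for some $S\in E$. Here $g[x\leftarrow d]$ and $G\langle X\leftarrow S\rangle$ are the usual updates. **Standard validity.** $\models^{d'}\varphi$ means: for all $I$, $g:V\to U$, $G:V_2\to\mathcal P(U)$, $\langle I,U,\mathcal P(U)\rangle,g,G\models^d\varphi$. **Elementary substructure.** $\langle I',D',E'\rangle\subseteq_E\langle I,D,E\rangle$ means: $D'\subseteq D$, $E'\subseteq E$, and for every formula $\psi$, every $g$ with $\mathrm{Range}(g)\subseteq D'$ and every $G$ with $\mathrm{Range}(G)\subseteq E'$, $\langle I',D',E'\rangle,g,G\models^d\psi$ iff $\langle I,D,E\rangle,g,G\models^d\psi$. (The subscript $E$ in $\subseteq_E$ is just part of the notation.) **Safe substitution.** $[x\leftarrow_r z](\varphi)$ (for $x,z\in V$) is capture-avoiding substitution: first rename every binder $\exists z$ in $\varphi$, together with the occurrences it binds, to $\exists w$ for a fresh variable $w$ (say the least one not occurring in $\varphi$ and different from $x,z$), then replace all free occurrences of $x$ by $z$. $[X\leftarrow_{r2}Z](\varphi)$ for $X,Z\in V_2$ is the analogous operation for second-order variables. Binders of one namespace do not interact with substitution in the other. Both operations preserve formula size. **Minimal-shallow translation.** For parameters $II$ (an interpretation over $U$), $gg:V\to U$, $GG:V_2\to\mathcal P(U)$, the truth value $(\!|\varphi|\!)=(\!|\varphi|\!)_{II,gg,GG}$ is defined by recursion on formula size: $(\!|r(x,y)|\!)$ is $(gg(x),gg(y))\in II(r)$; $(\!|X(x)|\!)$ is $gg(x)\in GG(X)$; $(\!|\neg\varphi|\!)$ is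 $\neg(\!|\varphi|\!)$; $(\!|\varphi\wedge\psi|\!)$ is $(\!|\varphi|\!)\wedge(\!|\psi|\!)$; $(\!|\exists x.\varphi|\!)$ is "there is a variable $z\in V$ with $(\!|[x\leftarrow_r z](\varphi)|\!)$"; $(\!|\exists X.\varphi|\!)$ is "there is a variable $Z\in V_2$ with $(\!|[X\leftarrow_{r2}Z](\varphi)|\!)$". *)

theory Defs
  imports Main
begin

type_synonym rsym = nat
type_synonym var1 = nat
type_synonym var2 = nat

datatype mso =
    Rel rsym var1 var1
  | App var2 var1
  | Neg mso
  | Conj mso mso
  | Ex1 var1 mso
  | Ex2 var2 mso

text \<open>The universe U is the type of individuals, which is nonempty like every HOL type.\<close>

type_synonym 'u interp = "rsym \<Rightarrow> 'u rel"
type_synonym 'u struct = "'u interp \<times> 'u set \<times> 'u set set"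

fun sat :: "'u struct \<Rightarrow> (var1 \<Rightarrow> 'u) \<Rightarrow> (var2 \<Rightarrow> 'u set) \<Rightarrow> mso \<Rightarrow> bool" where
  "sat (I, D, E) g G (Rel r x y) \<longleftrightarrow> (g x, g y) \<in> I r"
| "sat (I, D, E) g G (App X x) \<longleftrightarrow> g x \<in> G X"
| "sat (I, D, E) g G (Neg \<phi>) \<longleftrightarrow> \<not> sat (I, D, E) g G \<phi>"
| "sat (I, D, E) g G (Conj \<phi> \<psi>) \<longleftrightarrow> sat (I, D, E) g G \<phi> \<and> sat (I, D, E) g G \<psi>"
| "sat (I, D, E) g G (Ex1 x \<phi>) \<longleftrightarrow> (\<exists>d\<in>D. sat (I, D, E) (g(x := d)) G \<phi>)"
| "sat (I, D, E) g G (Ex2 X \<phi>) \<longleftrightarrow> (\<exists>S\<in>E. sat (I, D, E) g (G(X := S)) \<phi>)"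

definition std_valid :: "'u itself \<Rightarrow> mso \<Rightarrow> bool" where
  "std_valid (U :: 'u itself) \<phi> \<longleftrightarrow>
     (\<forall>(I :: 'u interp) g G. sat (I, UNIV, UNIV) g G \<phi>)"

fun elem_substruct :: "'u struct \<Rightarrow> 'u struct \<Rightarrow> bool" where
  "elem_substruct (I', D', E') (I, D, E) \<longleftrightarrow>
     D' \<subseteq> D \<and> E' \<subseteq> E \<and>
     (\<forall>\<psi> g G. range g \<subseteq> D' \<longrightarrow> range G \<subseteq> E' \<longrightarrow>
        (sat (I', D', E') g G \<psi> \<longleftrightarrow> sat (I, D, E) g G \<psi>))"

text \<open>All variables of a formula, bound ones (including the binders themselves) as well as free ones.\<close>

primrec vars1 :: "mso \<Rightarrow> var1 set" where
  "vars1 (Rel r x y) = {x, y}"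
| "vars1 (App X x) = {x}"
| "vars1 (Neg \<phi>) = vars1 \<phi>"
| "vars1 (Conj \<phi> \<psi>) = vars1 \<phi> \<union> vars1 \<psi>"
| "vars1 (Ex1 x \<phi>) = insert x (vars1 \<phi>)"
| "vars1 (Ex2 X \<phi>) = vars1 \<phi>"

primrec vars2 :: "mso \<Rightarrow> var2 set" where
  "vars2 (Rel r x y) = {}"
| "vars2 (App X x) = {X}"
| "vars2 (Neg \<phi>) = vars2 \<phi>"
| "vars2 (Conj \<phi> \<psi>) = vars2 \<phi> \<union> vars2 \<psi>"
| "vars2 (Ex1 x \<phi>) = vars2 \<phi>"
| "vars2 (Ex2 X \<phi>) = insert X (vars2 \<phi>)"

text \<open>Replacement of the free occurrences of \<open>x\<close> by \<open>z\<close>, with no protection against capture.\<close>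

primrec repl1 :: "var1 \<Rightarrow> var1 \<Rightarrow> mso \<Rightarrow> mso" where
  "repl1 x z (Rel r u v) = Rel r (if u = x then z else u) (if v = x then z else v)"
| "repl1 x z (App X u) = App X (if u = x then z else u)"
| "repl1 x z (Neg \<phi>) = Neg (repl1 x z \<phi>)"
| "repl1 x z (Conj \<phi> \<psi>) = Conj (repl1 x z \<phi>) (repl1 x z \<psi>)"
| "repl1 x z (Ex1 u \<phi>) = (if u = x then Ex1 u \<phi> else Ex1 u (repl1 x z \<phi>))"
| "repl1 x z (Ex2 X \<phi>) = Ex2 X (repl1 x z \<phi>)"

primrec repl2 :: "var2 \<Rightarrow> var2 \<Rightarrow> mso \<Rightarrow> mso" where
  "repl2 X Z (Rel r u v) = Rel r u v"
| "repl2 X Z (App Y u) = App (if Y = X then Z else Y) u"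
| "repl2 X Z (Neg \<phi>) = Neg (repl2 X Z \<phi>)"
| "repl2 X Z (Conj \<phi> \<psi>) = Conj (repl2 X Z \<phi>) (repl2 X Z \<psi>)"
| "repl2 X Z (Ex1 u \<phi>) = Ex1 u (repl2 X Z \<phi>)"
| "repl2 X Z (Ex2 Y \<phi>) = (if Y = X then Ex2 Y \<phi> else Ex2 Y (repl2 X Z \<phi>))"

text \<open>Renaming of every binder of \<open>z\<close>, together with the occurrences it binds, to \<open>w\<close>. After the
  recursive call, the occurrences of \<open>z\<close> left in the body are exactly those bound by the outer
  binder.\<close>

primrec rename1 :: "var1 \<Rightarrow> var1 \<Rightarrow> mso \<Rightarrow> mso" where
  "rename1 z w (Rel r u v) = Rel r u v"
| "rename1 z w (App X u) = App X u"
| "rename1 z w (Neg \<phi>) = Neg (rename1 z w \<phi>)"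
| "rename1 z w (Conj \<phi> \<psi>) = Conj (rename1 z w \<phi>) (rename1 z w \<psi>)"
| "rename1 z w (Ex1 u \<phi>) =
     (if u = z then Ex1 w (repl1 z w (rename1 z w \<phi>)) else Ex1 u (rename1 z w \<phi>))"
| "rename1 z w (Ex2 X \<phi>) = Ex2 X (rename1 z w \<phi>)"

primrec rename2 :: "var2 \<Rightarrow> var2 \<Rightarrow> mso \<Rightarrow> mso" where
  "rename2 Z W (Rel r u v) = Rel r u v"
| "rename2 Z W (App X u) = App X u"
| "rename2 Z W (Neg \<phi>) = Neg (rename2 Z W \<phi>)"
| "rename2 Z W (Conj \<phi> \<psi>) = Conj (rename2 Z W \<phi>) (rename2 Z W \<psi>)"
| "rename2 Z W (Ex1 u \<phi>) = Ex1 u (rename2 Z W \<phi>)"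
| "rename2 Z W (Ex2 Y \<phi>) =
     (if Y = Z then Ex2 W (repl2 Z W (rename2 Z W \<phi>)) else Ex2 Y (rename2 Z W \<phi>))"

definition safe_subst1 :: "var1 \<Rightarrow> var1 \<Rightarrow> mso \<Rightarrow> mso" where
  "safe_subst1 x z \<phi> = repl1 x z (rename1 z (LEAST w. w \<notin> vars1 \<phi> \<union> {x, z}) \<phi>)"

definition safe_subst2 :: "var2 \<Rightarrow> var2 \<Rightarrow> mso \<Rightarrow> mso" where
  "safe_subst2 X Z \<phi> = repl2 X Z (rename2 Z (LEAST W. W \<notin> vars2 \<phi> \<union> {X, Z}) \<phi>)"

primrec fsize :: "mso \<Rightarrow> nat" where
  "fsize (Rel r x y) = 1"
| "fsize (App X x) = 1"
| "fsize (Neg \<phi>) = Suc (fsize \<phi>)"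
| "fsize (Conj \<phi> \<psi>) = Suc (fsize \<phi> + fsize \<psi>)"
| "fsize (Ex1 x \<phi>) = Suc (fsize \<phi>)"
| "fsize (Ex2 X \<phi>) = Suc (fsize \<phi>)"

lemma fsize_repl1 [simp]: "fsize (repl1 x z \<phi>) = fsize \<phi>"
  by (induction \<phi>) simp_all

lemma fsize_repl2 [simp]: "fsize (repl2 X Z \<phi>) = fsize \<phi>"
  by (induction \<phi>) simp_all

lemma fsize_rename1 [simp]: "fsize (rename1 z w \<phi>) = fsize \<phi>"
  by (induction \<phi>) simp_all

lemma fsize_rename2 [simp]: "fsize (rename2 Z W \<phi>) = fsize \<phi>"
  by (induction \<phi>) simp_all

lemma fsize_safe_subst1 [simp]: "fsize (safe_subst1 x z \<phi>) = fsize \<phi>"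
  by (simp add: safe_subst1_def)

lemma fsize_safe_subst2 [simp]: "fsize (safe_subst2 X Z \<phi>) = fsize \<phi>"
  by (simp add: safe_subst2_def)

text \<open>The quantifiers range over variables, not over individuals or sets: the only individuals and
  sets seen are those named by \<open>gg\<close> and \<open>GG\<close>.\<close>

function min_shallow ::
  "'u interp \<Rightarrow> (var1 \<Rightarrow> 'u) \<Rightarrow> (var2 \<Rightarrow> 'u set) \<Rightarrow> mso \<Rightarrow> bool" where
  "min_shallow II gg GG (Rel r x y) \<longleftrightarrow> (gg x, gg y) \<in> II r"
| "min_shallow II gg GG (App X x) \<longleftrightarrow> gg x \<in> GG X"
| "min_shallow II gg GG (Neg \<phi>) \<longleftrightarrow> \<not> min_shallow II gg GG \<phi>"
| "min_shallow II gg GG (Conj \<phi> \<psi>) \<longleftrightarrow> min_shallow II gg GG \<phi> \<and> min_shallow II gg GG \<psi>"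
| "min_shallow II gg GG (Ex1 x \<phi>) \<longleftrightarrow> (\<exists>z. min_shallow II gg GG (safe_subst1 x z \<phi>))"
| "min_shallow II gg GG (Ex2 X \<phi>) \<longleftrightarrow> (\<exists>Z. min_shallow II gg GG (safe_subst2 X Z \<phi>))"
  by pat_completeness auto
termination
  by (relation "measure (\<lambda>(II, gg, GG, \<phi>). fsize \<phi>)") simp_all

end

(* With variables as names for the elements of the structure, the minimal-shallow translation is
   truth in the structure whose domains are Range(gg) and Range(GG); this is the substitution lemma.
   One direction is then the definition of an elementary substructure. For the other, the downward
   Loewenheim-Skolem theorem embeds the values of a countermodel in a countable elementary
   substructure of the full model, and since a formula has finitely many free variables, the
   remaining variables can be used to enumerate that substructure. *)

theory Submission
  imports Defs "HOL-Library.Countable_Set"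
begin

section \<open>Substitution\<close>

primrec free1 :: "mso \<Rightarrow> var1 set" where
  "free1 (Rel r x y) = {x, y}"
| "free1 (App X x) = {x}"
| "free1 (Neg \<phi>) = free1 \<phi>"
| "free1 (Conj \<phi> \<psi>) = free1 \<phi> \<union> free1 \<psi>"
| "free1 (Ex1 x \<phi>) = free1 \<phi> - {x}"
| "free1 (Ex2 X \<phi>) = free1 \<phi>"

primrec free2 :: "mso \<Rightarrow> var2 set" where
  "free2 (Rel r x y) = {}"
| "free2 (App X x) = {X}"
| "free2 (Neg \<phi>) = free2 \<phi>"
| "free2 (Conj \<phi> \<psi>) = free2 \<phi> \<union> free2 \<psi>"
| "free2 (Ex1 x \<phi>) = free2 \<phi>"
| "free2 (Ex2 X \<phi>) = free2 \<phi> - {X}"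

primrec bound1 :: "mso \<Rightarrow> var1 set" where
  "bound1 (Rel r x y) = {}"
| "bound1 (App X x) = {}"
| "bound1 (Neg \<phi>) = bound1 \<phi>"
| "bound1 (Conj \<phi> \<psi>) = bound1 \<phi> \<union> bound1 \<psi>"
| "bound1 (Ex1 x \<phi>) = insert x (bound1 \<phi>)"
| "bound1 (Ex2 X \<phi>) = bound1 \<phi>"

primrec bound2 :: "mso \<Rightarrow> var2 set" where
  "bound2 (Rel r x y) = {}"
| "bound2 (App X x) = {}"
| "bound2 (Neg \<phi>) = bound2 \<phi>"
| "bound2 (Conj \<phi> \<psi>) = bound2 \<phi> \<union> bound2 \<psi>"
| "bound2 (Ex1 x \<phi>) = bound2 \<phi>"
| "bound2 (Ex2 X \<phi>) = insert X (bound2 \<phi>)"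

text \<open>No free occurrence of \<open>x\<close> lies in the scope of a binder of \<open>z\<close>. A binder of \<open>z\<close> may occur
  elsewhere: renaming nested binders of \<open>x\<close> to \<open>z\<close> from the inside out produces such formulas.\<close>

primrec free_for1 :: "var1 \<Rightarrow> var1 \<Rightarrow> mso \<Rightarrow> bool" where
  "free_for1 x z (Rel r u v) \<longleftrightarrow> True"
| "free_for1 x z (App X u) \<longleftrightarrow> True"
| "free_for1 x z (Neg \<phi>) \<longleftrightarrow> free_for1 x z \<phi>"
| "free_for1 x z (Conj \<phi> \<psi>) \<longleftrightarrow> free_for1 x z \<phi> \<and> free_for1 x z \<psi>"
| "free_for1 x z (Ex1 u \<phi>) \<longleftrightarrow> u = x \<or> x \<notin> free1 \<phi> \<or> u \<noteq> z \<and> free_for1 x z \<phi>"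
| "free_for1 x z (Ex2 X \<phi>) \<longleftrightarrow> free_for1 x z \<phi>"

primrec free_for2 :: "var2 \<Rightarrow> var2 \<Rightarrow> mso \<Rightarrow> bool" where
  "free_for2 X Z (Rel r u v) \<longleftrightarrow> True"
| "free_for2 X Z (App Y u) \<longleftrightarrow> True"
| "free_for2 X Z (Neg \<phi>) \<longleftrightarrow> free_for2 X Z \<phi>"
| "free_for2 X Z (Conj \<phi> \<psi>) \<longleftrightarrow> free_for2 X Z \<phi> \<and> free_for2 X Z \<psi>"
| "free_for2 X Z (Ex1 u \<phi>) \<longleftrightarrow> free_for2 X Z \<phi>"
| "free_for2 X Z (Ex2 Y \<phi>) \<longleftrightarrow> Y = X \<or> X \<notin> free2 \<phi> \<or> Y \<noteq> Z \<and> free_for2 X Z \<phi>"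

lemma finite_vars1: "finite (vars1 \<phi>)"
  by (induction \<phi>) simp_all

lemma finite_vars2: "finite (vars2 \<phi>)"
  by (induction \<phi>) simp_all

lemma free1_subset_vars1: "free1 \<phi> \<subseteq> vars1 \<phi>"
  by (induction \<phi>) auto

lemma free2_subset_vars2: "free2 \<phi> \<subseteq> vars2 \<phi>"
  by (induction \<phi>) auto

lemma finite_free1: "finite (free1 \<phi>)"
  by (rule finite_subset[OF free1_subset_vars1 finite_vars1])

lemma finite_free2: "finite (free2 \<phi>)"
  by (rule finite_subset[OF free2_subset_vars2 finite_vars2])

text \<open>Truth depends on finitely many values only: this makes fresh variables harmless, lets
  finite lists code assignments, and leaves all but finitely many variables available as
  names.\<close>

lemma sat_cong:
  assumes "\<And>x. x \<in> free1 \<phi> \<Longrightarrow> g x = h x" "\<And>X. X \<in> free2 \<phi> \<Longrightarrow> G X = H X"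
  shows "sat (I, D, E) g G \<phi> \<longleftrightarrow> sat (I, D, E) h H \<phi>"
  using assms
proof (induction \<phi> arbitrary: g h G H)
  case (Conj \<phi> \<psi>)
  have "sat (I, D, E) g G \<phi> \<longleftrightarrow> sat (I, D, E) h H \<phi>"
    using Conj.prems by (intro Conj.IH(1)) auto
  moreover have "sat (I, D, E) g G \<psi> \<longleftrightarrow> sat (I, D, E) h H \<psi>"
    using Conj.prems by (intro Conj.IH(2)) auto
  ultimately show ?case by simp
next
  case (Neg \<phi>)
  have "sat (I, D, E) g G \<phi> \<longleftrightarrow> sat (I, D, E) h H \<phi>"
    using Neg.prems by (intro Neg.IH) auto
  then show ?case by simp
next
  case (Ex1 x \<phi>)
  have "sat (I, D, E) (g(x := d)) G \<phi> \<longleftrightarrow> sat (I, D, E) (h(x := d)) H \<phi>" for d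
    using Ex1.prems by (intro Ex1.IH) auto
  then show ?case by simp
next
  case (Ex2 X \<phi>)
  have "sat (I, D, E) g (G(X := S)) \<phi> \<longleftrightarrow> sat (I, D, E) h (H(X := S)) \<phi>" for S
    using Ex2.prems by (intro Ex2.IH) auto
  then show ?case by simp
qed auto

section \<open>Truth under replacement of free variables\<close>

lemma repl1_id: "x \<notin> free1 \<phi> \<Longrightarrow> repl1 x z \<phi> = \<phi>"
  by (induction \<phi>) auto

lemma repl2_id: "X \<notin> free2 \<phi> \<Longrightarrow> repl2 X Z \<phi> = \<phi>"
  by (induction \<phi>) auto

lemma sat_repl1:
  "free_for1 x z \<phi> \<Longrightarrow> sat (I, D, E) g G (repl1 x z \<phi>) \<longleftrightarrow> sat (I, D, E) (g(x := g z)) G \<phi>"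
proof (induction \<phi> arbitrary: g G)
  case (Ex1 u \<phi>)
  consider "u = x" | "u \<noteq> x" "x \<notin> free1 \<phi>" | "u \<noteq> x" "u \<noteq> z" "free_for1 x z \<phi>"
    using Ex1.prems by auto
  then show ?case
  proof cases
    \<comment> \<open>The body has no free \<open>x\<close>, so \<open>repl1\<close> leaves it alone
      and the new value at \<open>x\<close> does not matter, even if \<open>u = z\<close>.\<close>
    case 2
    then have "sat (I, D, E) (g(u := d)) G \<phi> \<longleftrightarrow> sat (I, D, E) (g(x := g z, u := d)) G \<phi>" for d
      by (intro sat_cong) auto
    with 2 show ?thesis by (simp add: repl1_id del: fun_upd_apply)
  next
    case 3
    then show ?thesis by (simp add: Ex1.IH fun_upd_twist fun_upd_other del: fun_upd_apply)
  qed (simp del: fun_upd_apply)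
qed auto

lemma sat_repl2:
  "free_for2 X Z \<phi> \<Longrightarrow> sat (I, D, E) g G (repl2 X Z \<phi>) \<longleftrightarrow> sat (I, D, E) g (G(X := G Z)) \<phi>"
proof (induction \<phi> arbitrary: g G)
  case (Ex2 Y \<phi>)
  consider "Y = X" | "Y \<noteq> X" "X \<notin> free2 \<phi>" | "Y \<noteq> X" "Y \<noteq> Z" "free_for2 X Z \<phi>"
    using Ex2.prems by auto
  then show ?case
  proof cases
    case 2
    then have "sat (I, D, E) g (G(Y := S)) \<phi> \<longleftrightarrow> sat (I, D, E) g (G(X := G Z, Y := S)) \<phi>" for S
      by (intro sat_cong) auto
    with 2 show ?thesis by (simp add: repl2_id del: fun_upd_apply)
  next
    case 3
    then show ?thesis by (simp add: Ex2.IH fun_upd_twist fun_upd_other del: fun_upd_apply)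
  qed (simp del: fun_upd_apply)
qed auto

section \<open>Renaming of bound variables\<close>

lemma not_free1_repl1: "x \<noteq> z \<Longrightarrow> x \<notin> free1 (repl1 x z \<phi>)"
  by (induction \<phi>) auto

lemma not_free2_repl2: "X \<noteq> Z \<Longrightarrow> X \<notin> free2 (repl2 X Z \<phi>)"
  by (induction \<phi>) auto

text \<open>A binder renamed to \<open>w\<close> has no free \<open>z\<close> left in its body, and
  every other binder differs from \<open>w\<close> by freshness. So the replacement made at an
  enclosing renamed binder captures nothing.\<close>

lemma free_for1_rename1: "w \<notin> vars1 \<phi> \<Longrightarrow> free_for1 z w (rename1 z w \<phi>)"
  by (induction \<phi>) (auto simp: not_free1_repl1)

lemma free_for2_rename2: "W \<notin> vars2 \<phi> \<Longrightarrow> free_for2 Z W (rename2 Z W \<phi>)"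
  by (induction \<phi>) (auto simp: not_free2_repl2)

lemma sat_rename1:
  "w \<notin> vars1 \<phi> \<Longrightarrow> sat (I, D, E) g G (rename1 z w \<phi>) \<longleftrightarrow> sat (I, D, E) g G \<phi>"
proof (induction \<phi> arbitrary: g G)
  case (Ex1 u \<phi>)
  then have w: "w \<notin> vars1 \<phi>" "w \<noteq> u" by auto
  \<comment> \<open>The renamed binder sets \<open>w\<close>, and \<open>sat_repl1\<close> copies
    that value to \<open>z\<close>; freshness of \<open>w\<close> removes the first update.\<close>
  have "sat (I, D, E) (g(w := d, z := d)) G \<phi> \<longleftrightarrow> sat (I, D, E) (g(z := d)) G \<phi>" for d
    using w free1_subset_vars1[of \<phi>] by (intro sat_cong) auto
  with w show ?case by (simp add: Ex1.IH sat_repl1 free_for1_rename1 fun_upd_same del: fun_upd_apply)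
qed auto

lemma sat_rename2:
  "W \<notin> vars2 \<phi> \<Longrightarrow> sat (I, D, E) g G (rename2 Z W \<phi>) \<longleftrightarrow> sat (I, D, E) g G \<phi>"
proof (induction \<phi> arbitrary: g G)
  case (Ex2 Y \<phi>)
  then have W: "W \<notin> vars2 \<phi>" "W \<noteq> Y" by auto
  have "sat (I, D, E) g (G(W := S, Z := S)) \<phi> \<longleftrightarrow> sat (I, D, E) g (G(Z := S)) \<phi>" for S
    using W free2_subset_vars2[of \<phi>] by (intro sat_cong) auto
  with W show ?case by (simp add: Ex2.IH sat_repl2 free_for2_rename2 fun_upd_same del: fun_upd_apply)
qed auto

section \<open>Correctness of safe substitution\<close>

lemma bound1_repl1: "bound1 (repl1 x z \<phi>) = bound1 \<phi>"
  by (induction \<phi>) auto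

lemma bound2_repl2: "bound2 (repl2 X Z \<phi>) = bound2 \<phi>"
  by (induction \<phi>) auto

lemma not_bound1_rename1: "w \<noteq> z \<Longrightarrow> z \<notin> bound1 (rename1 z w \<phi>)"
  by (induction \<phi>) (auto simp: bound1_repl1)

lemma not_bound2_rename2: "W \<noteq> Z \<Longrightarrow> Z \<notin> bound2 (rename2 Z W \<phi>)"
  by (induction \<phi>) (auto simp: bound2_repl2)

lemma free_for1_if_not_bound1: "z \<notin> bound1 \<phi> \<Longrightarrow> free_for1 x z \<phi>"
  by (induction \<phi>) auto

lemma free_for2_if_not_bound2: "Z \<notin> bound2 \<phi> \<Longrightarrow> free_for2 X Z \<phi>"
  by (induction \<phi>) auto

lemma sat_safe_subst1:
  "sat (I, D, E) g G (safe_subst1 x z \<phi>) \<longleftrightarrow> sat (I, D, E) (g(x := g z)) G \<phi>"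
proof -
  define w where "w = (LEAST w. w \<notin> vars1 \<phi> \<union> {x, z})"
  have "\<exists>w. w \<notin> vars1 \<phi> \<union> {x, z}"
    by (intro ex_new_if_finite) (simp_all add: finite_vars1)
  \<comment> \<open>\<open>w \<noteq> z\<close> removes \<open>z\<close> from the binders of the
    renamed formula, so the replacement cannot capture; \<open>w \<notin> vars1 \<phi>\<close> makes
    the renaming preserve truth.\<close>
  then have "w \<notin> vars1 \<phi> \<union> {x, z}"
    unfolding w_def by (rule LeastI_ex)
  then show ?thesis
    unfolding safe_subst1_def w_def[symmetric]
    by (simp add: sat_repl1 free_for1_if_not_bound1 not_bound1_rename1 sat_rename1)
qed

lemma sat_safe_subst2:
  "sat (I, D, E) g G (safe_subst2 X Z \<phi>) \<longleftrightarrow> sat (I, D, E) g (G(X := G Z)) \<phi>"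
proof -
  define W where "W = (LEAST W. W \<notin> vars2 \<phi> \<union> {X, Z})"
  have "\<exists>W. W \<notin> vars2 \<phi> \<union> {X, Z}"
    by (intro ex_new_if_finite) (simp_all add: finite_vars2)
  then have "W \<notin> vars2 \<phi> \<union> {X, Z}"
    unfolding W_def by (rule LeastI_ex)
  then show ?thesis
    unfolding safe_subst2_def W_def[symmetric]
    by (simp add: sat_repl2 free_for2_if_not_bound2 not_bound2_rename2 sat_rename2)
qed

text \<open>Substituting \<open>z\<close> for \<open>x\<close> amounts to giving \<open>x\<close>
  the value \<open>gg z\<close>, so quantifying over variables is quantifying over the ranges. The
  induction is on size because a substituted body need not be a subformula.\<close>

lemma min_shallow_iff_sat:
  "min_shallow II gg GG \<phi> \<longleftrightarrow> sat (II, range gg, range GG) gg GG \<phi>"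
proof (induction \<phi> rule: measure_induct_rule[of fsize])
  case (less \<phi>)
  then show ?case
    by (cases \<phi>) (simp_all add: sat_safe_subst1 sat_safe_subst2)
qed

section \<open>Downward Loewenheim-Skolem\<close>

lemma lists_UN_chain:
  fixes A :: "nat \<Rightarrow> 'a set"
  assumes "mono A" "xs \<in> lists (\<Union>n. A n)"
  obtains n where "xs \<in> lists (A n)"
proof -
  have "\<exists>n. xs \<in> lists (A n)"
    using assms(2)
  proof (induction xs)
    case (Cons x xs)
    then obtain m n where "x \<in> A m" "xs \<in> lists (A n)" by auto
    then have "x # xs \<in> lists (A (max m n))"
      using monoD[OF assms(1), of m "max m n"] monoD[OF assms(1), of n "max m n"] by auto
    then show ?case ..
  qed auto
  with that show thesis by blast
qed

text \<open>Both sets grow together because each operation takes arguments of both sorts. Finite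
  argument lists already lie in some stage of the iteration, and each stage stays countable because
  there are only countably many indices and lists.\<close>

lemma countable_two_sorted_closure:
  fixes F :: "'c::countable \<Rightarrow> 'a list \<Rightarrow> 'b list \<Rightarrow> 'a"
    and H :: "'c \<Rightarrow> 'a list \<Rightarrow> 'b list \<Rightarrow> 'b"
  assumes "countable A" "countable B"
  obtains D E where "countable D" "countable E" "A \<subseteq> D" "B \<subseteq> E"
    "\<And>c xs Xs. xs \<in> lists D \<Longrightarrow> Xs \<in> lists E \<Longrightarrow> F c xs Xs \<in> D \<and> H c xs Xs \<in> E"
proof -
  define step where "step = (\<lambda>(D, E).
    (D \<union> (\<lambda>(c, xs, Xs). F c xs Xs) ` (UNIV \<times> lists D \<times> lists E),
     E \<union> (\<lambda>(c, xs, Xs). H c xs Xs) ` (UNIV \<times> lists D \<times> lists E)))"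
  define S where "S n = (step ^^ n) (A, B)" for n
  have S_0: "S 0 = (A, B)" and S_Suc: "S (Suc n) = step (S n)" for n
    by (simp_all add: S_def)
  have fst_step: "fst (S (Suc n)) = fst (S n) \<union>
      (\<lambda>(c, xs, Xs). F c xs Xs) ` (UNIV \<times> lists (fst (S n)) \<times> lists (snd (S n)))"
    and snd_step: "snd (S (Suc n)) = snd (S n) \<union>
      (\<lambda>(c, xs, Xs). H c xs Xs) ` (UNIV \<times> lists (fst (S n)) \<times> lists (snd (S n)))" for n
    by (simp_all add: S_Suc step_def split_beta)
  have countable: "countable (fst (S n)) \<and> countable (snd (S n))" for n
  proof (induction n)
    case 0
    with assms show ?case by (simp add: S_0)
  next
    case (Suc n)
    then show ?case
      unfolding fst_step snd_step
      by (intro conjI countable_Un countable_image countable_SIGMA countable_lists) auto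
  qed
  have mono: "mono (\<lambda>n. fst (S n))" "mono (\<lambda>n. snd (S n))"
    unfolding mono_iff_le_Suc fst_step snd_step by blast+
  show thesis
  proof
    show "countable (\<Union>n. fst (S n))" "countable (\<Union>n. snd (S n))"
      using countable by auto
    show "A \<subseteq> (\<Union>n. fst (S n))"
      using UN_upper[of 0 UNIV "\<lambda>n. fst (S n)"] by (simp add: S_0)
    show "B \<subseteq> (\<Union>n. snd (S n))"
      using UN_upper[of 0 UNIV "\<lambda>n. snd (S n)"] by (simp add: S_0)
    fix c :: 'c and xs Xs
    assume "xs \<in> lists (\<Union>n. fst (S n))" "Xs \<in> lists (\<Union>n. snd (S n))"
    then obtain m n where "xs \<in> lists (fst (S m))" "Xs \<in> lists (snd (S n))"
      using mono by (meson lists_UN_chain)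
    \<comment> \<open>The arguments of the two sorts may appear at different stages; the values
      enter right after the later one.\<close>
    then have "xs \<in> lists (fst (S (max m n)))" "Xs \<in> lists (snd (S (max m n)))"
      using monoD[OF mono(1), of m "max m n"] monoD[OF mono(2), of n "max m n"] by auto
    then have "(c, xs, Xs) \<in> UNIV \<times> lists (fst (S (max m n))) \<times> lists (snd (S (max m n)))"
      by simp
    then have "F c xs Xs \<in> fst (S (Suc (max m n)))" "H c xs Xs \<in> snd (S (Suc (max m n)))"
      unfolding fst_step snd_step by (force intro!: UnI2)+
    then show "F c xs Xs \<in> (\<Union>n. fst (S n)) \<and> H c xs Xs \<in> (\<Union>n. snd (S n))"
      by blast
  qed
qed

text \<open>A witness in the full structure is traded for one in \<open>D\<close> or
  \<open>E\<close>; the updated assignment then still takes its values there, so the induction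
  hypothesis applies to it.\<close>

lemma tarski_vaught:
  assumes wit1: "\<And>\<psi> x g G. range g \<subseteq> D \<Longrightarrow> range G \<subseteq> E \<Longrightarrow>
      sat (I, UNIV, UNIV) g G (Ex1 x \<psi>) \<Longrightarrow> \<exists>d\<in>D. sat (I, UNIV, UNIV) (g(x := d)) G \<psi>"
    and wit2: "\<And>\<psi> X g G. range g \<subseteq> D \<Longrightarrow> range G \<subseteq> E \<Longrightarrow>
      sat (I, UNIV, UNIV) g G (Ex2 X \<psi>) \<Longrightarrow> \<exists>S\<in>E. sat (I, UNIV, UNIV) g (G(X := S)) \<psi>"
  shows "elem_substruct (I, D, E) (I, UNIV, UNIV)"
proof -
  have "sat (I, D, E) g G \<psi> \<longleftrightarrow> sat (I, UNIV, UNIV) g G \<psi>"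
    if "range g \<subseteq> D" "range G \<subseteq> E" for \<psi> g G
    using that
  proof (induction \<psi> arbitrary: g G)
    case (Ex1 x \<psi>)
    have "sat (I, D, E) (g(x := d)) G \<psi> \<longleftrightarrow> sat (I, UNIV, UNIV) (g(x := d)) G \<psi>" if "d \<in> D" for d
      using Ex1.prems that by (intro Ex1.IH) auto
    with wit1[OF Ex1.prems, of x \<psi>] show ?case by auto
  next
    case (Ex2 X \<psi>)
    have "sat (I, D, E) g (G(X := S)) \<psi> \<longleftrightarrow> sat (I, UNIV, UNIV) g (G(X := S)) \<psi>" if "S \<in> E" for S
      using Ex2.prems that by (intro Ex2.IH) auto
    with wit2[OF Ex2.prems, of X \<psi>] show ?case by auto
  qed auto
  then show ?thesis by simp
qed

instance mso :: countable
  by countable_datatype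

text \<open>Codes an assignment by a finite list with fallback \<open>f\<close>. A countable set has
  only countably many finite lists, but may have uncountably many assignments into it; hence the
  Skolem functions take lists.\<close>

definition list_override :: "(nat \<Rightarrow> 'a) \<Rightarrow> 'a list \<Rightarrow> nat \<Rightarrow> 'a" where
  "list_override f xs n = (if n < length xs then xs ! n else f n)"

lemma finite_agree_list_override:
  fixes N :: "nat set"
  assumes "finite N" "range g \<subseteq> D"
  obtains xs where "xs \<in> lists D" "\<And>n. n \<in> N \<Longrightarrow> list_override f xs n = g n"
proof -
  obtain k where k: "\<forall>n\<in>N. n < k"
    using assms(1) finite_nat_set_iff_bounded by blast
  show thesis
  proof
    show "list_override f (map g [0..<k]) n = g n" if "n \<in> N" for n
      using k that by (simp add: list_override_def)
    show "map g [0..<k] \<in> lists D"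
      using assms(2) by (auto simp: image_subset_iff)
  qed
qed

text \<open>There is one Skolem function for each pair of a formula and a quantified variable, hence
  countably many. Closing \<open>A\<close> and \<open>B\<close> under them provides the witnesses of
  the Tarski-Vaught test.\<close>

lemma downward_loewenheim_skolem:
  fixes I :: "'u interp" and A :: "'u set" and B :: "'u set set"
  assumes "countable A" "countable B"
  obtains D E where "countable D" "countable E" "A \<subseteq> D" "B \<subseteq> E"
    "elem_substruct (I, D, E) (I, UNIV, UNIV)"
proof -
  \<comment> \<open>The fallback \<open>undefined\<close> may lie outside \<open>D\<close>. This is
    harmless, since the lists are chosen to agree with the given assignment on the free variables of
    \<open>\<psi>\<close>.\<close>
  define sk1 where "sk1 = (\<lambda>(\<psi>, x) xs Xs. SOME d. sat (I, UNIV, UNIV)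
    ((list_override undefined xs)(x := d)) (list_override undefined Xs) \<psi>)"
  define sk2 where "sk2 = (\<lambda>(\<psi>, X) xs Xs. SOME S. sat (I, UNIV, UNIV)
    (list_override undefined xs) ((list_override undefined Xs)(X := S)) \<psi>)"
  obtain D E where DE: "countable D" "countable E" "A \<subseteq> D" "B \<subseteq> E"
    and closed: "\<And>c xs Xs. xs \<in> lists D \<Longrightarrow> Xs \<in> lists E \<Longrightarrow> sk1 c xs Xs \<in> D \<and> sk2 c xs Xs \<in> E"
    using countable_two_sorted_closure[OF assms, of sk1 sk2] by blast
  have "elem_substruct (I, D, E) (I, UNIV, UNIV)"
  proof (rule tarski_vaught)
    fix \<psi> x and g :: "var1 \<Rightarrow> 'u" and G :: "var2 \<Rightarrow> 'u set"
    assume ranges: "range g \<subseteq> D" "range G \<subseteq> E" and ex: "sat (I, UNIV, UNIV) g G (Ex1 x \<psi>)"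
    obtain xs where xs: "xs \<in> lists D" "\<And>n. n \<in> free1 \<psi> \<Longrightarrow> list_override undefined xs n = g n"
      using finite_agree_list_override[OF finite_free1 ranges(1)] by blast
    obtain Xs where Xs: "Xs \<in> lists E" "\<And>n. n \<in> free2 \<psi> \<Longrightarrow> list_override undefined Xs n = G n"
      using finite_agree_list_override[OF finite_free2 ranges(2)] by blast
    have agree: "sat (I, UNIV, UNIV) ((list_override undefined xs)(x := d))
        (list_override undefined Xs) \<psi> \<longleftrightarrow> sat (I, UNIV, UNIV) (g(x := d)) G \<psi>" for d
      using xs(2) Xs(2) by (intro sat_cong) auto
    \<comment> \<open>By \<open>agree\<close>, the value chosen for the lists is also a witness for
      \<open>g\<close> and \<open>G\<close>.\<close>
    have "sat (I, UNIV, UNIV) (g(x := sk1 (\<psi>, x) xs Xs)) G \<psi>"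
      unfolding sk1_def case_prod_conv agree using ex by (simp only: sat.simps bex_UNIV) (erule someI_ex)
    with closed[OF xs(1) Xs(1)] show "\<exists>d\<in>D. sat (I, UNIV, UNIV) (g(x := d)) G \<psi>"
      by blast
  next
    fix \<psi> X and g :: "var1 \<Rightarrow> 'u" and G :: "var2 \<Rightarrow> 'u set"
    assume ranges: "range g \<subseteq> D" "range G \<subseteq> E" and ex: "sat (I, UNIV, UNIV) g G (Ex2 X \<psi>)"
    obtain xs where xs: "xs \<in> lists D" "\<And>n. n \<in> free1 \<psi> \<Longrightarrow> list_override undefined xs n = g n"
      using finite_agree_list_override[OF finite_free1 ranges(1)] by blast
    obtain Xs where Xs: "Xs \<in> lists E" "\<And>n. n \<in> free2 \<psi> \<Longrightarrow> list_override undefined Xs n = G n"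
      using finite_agree_list_override[OF finite_free2 ranges(2)] by blast
    have agree: "sat (I, UNIV, UNIV) (list_override undefined xs)
        ((list_override undefined Xs)(X := S)) \<psi> \<longleftrightarrow> sat (I, UNIV, UNIV) g (G(X := S)) \<psi>" for S
      using xs(2) Xs(2) by (intro sat_cong) auto
    have "sat (I, UNIV, UNIV) g (G(X := sk2 (\<psi>, X) xs Xs)) \<psi>"
      unfolding sk2_def case_prod_conv agree using ex by (simp only: sat.simps bex_UNIV) (erule someI_ex)
    with closed[OF xs(1) Xs(1)] show "\<exists>S\<in>E. sat (I, UNIV, UNIV) g (G(X := S)) \<psi>"
      by blast
  qed
  with DE show thesis by (rule that)
qed

section \<open>Naming a countable substructure by variables\<close>

lemma enumeration_extending_finite_part:
  fixes N :: "nat set"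
  assumes "countable D" "range g \<subseteq> D" "finite N"
  obtains f where "range f = D" "\<And>n. n \<in> N \<Longrightarrow> f n = g n"
proof -
  obtain k where k: "\<forall>n\<in>N. n < k"
    using assms(3) finite_nat_set_iff_bounded by blast
  \<comment> \<open>The shift by \<open>k\<close> starts the enumeration only after the values kept
    from \<open>g\<close>, so no element of \<open>D\<close> is lost; repetitions in
    \<open>from_nat_into\<close> cover finite \<open>D\<close>.\<close>
  let ?f = "\<lambda>n. if n < k then g n else from_nat_into D (n - k)"
  have D: "D \<noteq> {}"
    using assms(2) by auto
  show thesis
  proof
    show "range ?f = D"
    proof
      show "range ?f \<subseteq> D"
        using assms(2) from_nat_into[OF D] by auto
      show "D \<subseteq> range ?f"
      proof
        fix d
        assume "d \<in> D"
        then obtain m where "from_nat_into D m = d"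
          using from_nat_into_surj[OF assms(1)] by blast
        then have "d = ?f (k + m)" by simp
        then show "d \<in> range ?f" by (rule range_eqI)
      qed
    qed
    show "?f n = g n" if "n \<in> N" for n
      using k that by simp
  qed
qed

theorem mainTheorem3:
  fixes \<phi> :: mso
  shows "std_valid TYPE('u) \<phi> \<longleftrightarrow>
    (\<forall>(II :: 'u interp) (gg :: var1 \<Rightarrow> 'u) (GG :: var2 \<Rightarrow> 'u set).
       elem_substruct (II, range gg, range GG) (II, UNIV, UNIV) \<longrightarrow> min_shallow II gg GG \<phi>)"
proof
  assume "std_valid TYPE('u) \<phi>"
  then show "\<forall>(II :: 'u interp) gg GG.
      elem_substruct (II, range gg, range GG) (II, UNIV, UNIV) \<longrightarrow> min_shallow II gg GG \<phi>"
    \<comment> \<open>Elementarity is applied to \<open>gg\<close> and \<open>GG\<close> themselves,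
      whose ranges are the two domains.\<close>
    by (auto simp: std_valid_def min_shallow_iff_sat)
next
  assume shallow: "\<forall>(II :: 'u interp) gg GG.
      elem_substruct (II, range gg, range GG) (II, UNIV, UNIV) \<longrightarrow> min_shallow II gg GG \<phi>"
  show "std_valid TYPE('u) \<phi>"
    unfolding std_valid_def
  proof (intro allI)
    fix I :: "'u interp" and g :: "var1 \<Rightarrow> 'u" and G :: "var2 \<Rightarrow> 'u set"
    \<comment> \<open>Variables are natural numbers, so an assignment has countably many values even
      over an uncountable universe.\<close>
    have "countable (range g)" "countable (range G)" by simp_all
    then obtain D E where DE: "countable D" "countable E" "range g \<subseteq> D" "range G \<subseteq> E"
      and elem: "elem_substruct (I, D, E) (I, UNIV, UNIV)"
      by (rule downward_loewenheim_skolem)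
    \<comment> \<open>Only the values at the free variables of \<open>\<phi>\<close> have to be
      kept; enough other variables remain to name all of \<open>D\<close>.\<close>
    obtain gg where gg: "range gg = D" "\<And>x. x \<in> free1 \<phi> \<Longrightarrow> gg x = g x"
      using enumeration_extending_finite_part[OF DE(1,3) finite_free1] by blast
    obtain GG where GG: "range GG = E" "\<And>X. X \<in> free2 \<phi> \<Longrightarrow> GG X = G X"
      using enumeration_extending_finite_part[OF DE(2,4) finite_free2] by blast
    have "sat (I, D, E) gg GG \<phi>"
      using shallow elem gg(1) GG(1) min_shallow_iff_sat by metis
    then have "sat (I, UNIV, UNIV) gg GG \<phi>"
      using elem gg(1) GG(1) by simp
    then show "sat (I, UNIV, UNIV) g G \<phi>"
      using sat_cong[of \<phi> gg g GG G, OF gg(2) GG(2)] by simp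
  qed
qed

end
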